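(* Let $G^\sigma$ be an oriented graph with vertex set $\{v_1,\dots,v_n\}$ and skew spectral radius $\rho_s(G^\sigma)$. For each $i$, let $d_i^+$ and $d_i^-$ be the out-degree and in-degree of $v_i$ in $G^\sigma$, and let $\tilde d_i=d_i^+-d_i^-$. Then $$\rho_s(G^\sigma)\geq\sqrt{\frac{\tilde d_1^{\,2}+\tilde d_2^{\,2}+\cdots+\tilde d_n^{\,2}}{n}}.$$
   Context: An oriented graph $G^\sigma$ of a simple graph $G$ on vertices $v_1,\dots,v_n$ is obtained by giving each edge of $G$ one of its two directions. Its skew adjacency matrix $S(G^\sigma)=(s_{ij})$ has $s_{ij}=1$, $s_{ji}=-1$ if $\langle v_i,v_j\rangle$ is an arc (tail $v_i$, head $v_j$), and $s_{ij}=s_{ji}=0$ otherwise. The skew spectral radius $\rho_s(G^\sigma)$ is the spectral radius of $S(G^\sigma)$. *)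

theory Defs
  imports
    "Graph_Theory.Pair_Digraph"
    "Jordan_Normal_Form.Spectral_Radius"
begin

text \<open>
  A finite simple graph is a \<^locale>\<open>pair_graph\<close>, i.e. a loopless digraph in which the edge
  \<open>uv\<close> is represented by the two pairs \<open>(u, v)\<close> and \<open>(v, u)\<close>. An orientation keeps exactly one
  of these two pairs for every edge; the pair \<open>(u, v)\<close> is the arc with tail \<open>u\<close> and head \<open>v\<close>.
\<close>

definition orientation_of :: "'a pair_pre_digraph \<Rightarrow> 'a pair_pre_digraph \<Rightarrow> bool" where
  "orientation_of D G \<longleftrightarrow>
     pverts D = pverts G \<and> parcs D \<subseteq> parcs G \<and>
     (\<forall>u v. (u, v) \<in> parcs G \<longrightarrow> ((u, v) \<in> parcs D \<longleftrightarrow> (v, u) \<notin> parcs D))"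

text \<open>
  The vertices are listed as \<open>v 0, \<dots>, v (n - 1)\<close>, since matrix indices start at 0.
\<close>

definition skew_adjacency_matrix ::
    "'a pair_pre_digraph \<Rightarrow> nat \<Rightarrow> (nat \<Rightarrow> 'a) \<Rightarrow> real mat" where
  "skew_adjacency_matrix D n v = mat n n (\<lambda>(i, j).
     if (v i, v j) \<in> parcs D then 1
     else if (v j, v i) \<in> parcs D then -1
     else 0)"

text \<open>
  The spectral radius is that of the matrix over the complex numbers: the eigenvalues of a real
  skew-symmetric matrix are purely imaginary.
\<close>

definition skew_spectral_radius ::
    "'a pair_pre_digraph \<Rightarrow> nat \<Rightarrow> (nat \<Rightarrow> 'a) \<Rightarrow> real" where
  "skew_spectral_radius D n v =
     spectral_radius (map_mat complex_of_real (skew_adjacency_matrix D n v))"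

definition degree_diff :: "'a pair_pre_digraph \<Rightarrow> 'a \<Rightarrow> int" where
  "degree_diff D x = int (out_degree (with_proj D) x) - int (in_degree (with_proj D) x)"

end

theory Submission
  imports Defs "HOL-Analysis.Convex"
begin

text \<open>
  For a real skew-symmetric matrix \<open>S\<close> the sequence \<open>k \<mapsto> \<parallel>S\<^sup>k x\<parallel>\<^sup>2\<close> is logarithmically convex, by
  Cauchy-Schwarz and because \<open>S\<close> can be moved to the other side of the scalar product up to sign.
  Hence it grows exponentially as soon as \<open>\<parallel>S x\<parallel> > \<parallel>x\<parallel>\<close>, whereas the powers of a matrix with
  spectral radius less than \<open>1\<close> are bounded. After rescaling, this yields \<open>\<parallel>S x\<parallel> \<le> \<rho>(S) \<parallel>x\<parallel>\<close>
  without diagonalising \<open>S\<close>. For the skew adjacency matrix and \<open>x = (1, \<dots>, 1)\<close>, the entries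
  of \<open>S x\<close> are the degree differences and \<open>\<parallel>x\<parallel>\<^sup>2 = n\<close>.
\<close>

unbundle no inner_syntax

text \<open>Log-convexity makes the ratios \<open>a (Suc k) / a k\<close> nondecreasing. They start
  at a value greater than 1, so the sequence dominates a growing geometric one.\<close>

lemma log_convex_unbounded:
  fixes a :: "nat \<Rightarrow> real"
  assumes nonneg: "\<And>k. 0 \<le> a k"
    and log_convex: "\<And>k. (a (Suc k))\<^sup>2 \<le> a k * a (Suc (Suc k))"
    and less: "a 0 < a 1"
  shows "\<exists>k. B < a k"
proof -
  \<comment> \<open>If \<open>a 0 = 0\<close>, log-convexity at 0 forces \<open>a 1 = 0\<close>,
    contradicting \<open>less\<close>.\<close>
  have a0: "a 0 > 0"
    using nonneg[of 0] less log_convex[of 0] by (cases "a 0 = 0") auto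
  define r where "r = a 1 / a 0"
  have r: "r > 1" using less a0 by (simp add: r_def)
  \<comment> \<open>Positivity is carried through the induction because the inductive step cancels
    the factor \<open>a k\<close>.\<close>
  have step: "0 < a k \<and> r * a k \<le> a (Suc k)" for k
  proof (induction k)
    case 0
    then show ?case using a0 by (simp add: r_def)
  next
    case (Suc k)
    have "0 < r * a k" using Suc r by simp
    then have pos: "0 < a (Suc k)" using Suc by linarith
    have "(r * a (Suc k)) * a k \<le> a (Suc k) * a (Suc k)"
      using mult_left_mono[OF conjunct2[OF Suc] nonneg[of "Suc k"]] by (simp add: ac_simps)
    also have "\<dots> \<le> a (Suc (Suc k)) * a k"
      using log_convex[of k] by (simp add: power2_eq_square ac_simps)
    finally show ?case using Suc pos by simp
  qed
  have growth: "r ^ k * a 0 \<le> a k" for k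
  proof (induction k)
    case (Suc k)
    have "r ^ Suc k * a 0 \<le> r * a k" using mult_left_mono[OF Suc, of r] r by (simp add: ac_simps)
    then show ?case using step[of k] by linarith
  qed simp
  obtain k where "B / a 0 < r ^ k" using real_arch_pow[OF r] by blast
  then have "B < r ^ k * a 0" using a0 by (simp add: field_simps)
  then show ?thesis using growth[of k] by (meson less_le_trans)
qed

lemma scalar_prod_self_nonneg: "0 \<le> x \<bullet> (x :: real vec)"
  by (auto simp: scalar_prod_def intro: sum_nonneg)

lemma scalar_prod_Cauchy_Schwarz:
  fixes x y :: "real vec"
  assumes "x \<in> carrier_vec n" "y \<in> carrier_vec n"
  shows "(x \<bullet> y)\<^sup>2 \<le> (x \<bullet> x) * (y \<bullet> y)"
  using assms Cauchy_Schwarz_ineq_sum[of "($) x" "($) y" "{0..<n}"]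
  by (simp add: scalar_prod_def power2_eq_square)

lemma skew_symmetric_scalar_prod:
  fixes A :: "'a :: comm_ring_1 mat"
  assumes A: "A \<in> carrier_mat n n" and skew: "transpose_mat A = - A"
    and x: "x \<in> carrier_vec n" and y: "y \<in> carrier_vec n"
  shows "(A *\<^sub>v x) \<bullet> y = - (x \<bullet> (A *\<^sub>v y))"
proof -
  have "(A *\<^sub>v x) \<bullet> y = x \<bullet> (transpose_mat A *\<^sub>v y)"
  proof -
    have Ax: "A *\<^sub>v x \<in> carrier_vec n" and Ay: "transpose_mat A *\<^sub>v y \<in> carrier_vec n"
      using A x y by auto
    show ?thesis
      using transpose_vec_mult_scalar[OF A x y] comm_scalar_prod[OF Ax y] comm_scalar_prod[OF Ay x]
      by simp
  qed
  also have "\<dots> = - (x \<bullet> (A *\<^sub>v y))"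
    using A x y by (simp add: skew)
  finally show ?thesis .
qed

lemma smult_mat_mult_vec:
  fixes A :: "'a :: comm_semiring_0 mat"
  assumes "A \<in> carrier_mat m n" "x \<in> carrier_vec n"
  shows "(c \<cdot>\<^sub>m A) *\<^sub>v x = c \<cdot>\<^sub>v (A *\<^sub>v x)"
  using assms by (intro eq_vecI) auto

lemma spectral_radius_nonneg:
  assumes "A \<in> carrier_mat n n" and "n > 0"
  shows "0 \<le> spectral_radius A"
  using spectral_radius_mem_max(1)[OF assms] by auto

text \<open>An eigenvector of \<open>c \<cdot>\<^sub>m A\<close> for \<open>l\<close> is an
  eigenvector of \<open>A\<close> for \<open>l / c\<close>; apply this to an \<open>l\<close> of
  maximal modulus.\<close>

lemma spectral_radius_smult_le:
  assumes A: "A \<in> carrier_mat n n" and n: "n > 0" and c: "c \<noteq> 0"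
  shows "spectral_radius (c \<cdot>\<^sub>m A) \<le> norm c * spectral_radius A"
proof -
  have cA: "c \<cdot>\<^sub>m A \<in> carrier_mat n n" using A by simp
  obtain l x where l: "spectral_radius (c \<cdot>\<^sub>m A) = norm l" and x: "eigenvector (c \<cdot>\<^sub>m A) x l"
    using spectral_radius_mem_max(1)[OF cA n] by (auto simp: spectrum_def eigenvalue_def)
  have xc: "x \<in> carrier_vec n" and x0: "x \<noteq> 0\<^sub>v n" and eq: "(c \<cdot>\<^sub>m A) *\<^sub>v x = l \<cdot>\<^sub>v x"
    using x A by (auto simp: eigenvector_def)
  have "c \<cdot>\<^sub>v (A *\<^sub>v x) = l \<cdot>\<^sub>v x" 
    using eq A xc by (simp add: smult_mat_mult_vec)
  then have "(1 / c) \<cdot>\<^sub>v (c \<cdot>\<^sub>v (A *\<^sub>v x)) = (1 / c) \<cdot>\<^sub>v (l \<cdot>\<^sub>v x)" by simp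
  then have "A *\<^sub>v x = (l / c) \<cdot>\<^sub>v x" using c by (simp add: smult_smult_assoc)
  then have "eigenvector A x (l / c)" using xc x0 A by (auto simp: eigenvector_def)
  then have "norm (l / c) \<le> spectral_radius A"
    by (intro spectral_radius_mem_max(2)[OF A n] imageI) (auto simp: spectrum_def eigenvalue_def)
  then show ?thesis using c by (simp add: l norm_divide field_simps)
qed

lemma skew_symmetric_contraction:
  fixes A :: "real mat"
  assumes A: "A \<in> carrier_mat n n" and skew: "transpose_mat A = - A"
    and x: "x \<in> carrier_vec n"
    and radius: "spectral_radius (map_mat complex_of_real A) < 1"
  shows "(A *\<^sub>v x) \<bullet> (A *\<^sub>v x) \<le> x \<bullet> x"
proof (rule ccontr)
  assume contr: "\<not> ?thesis"
  define y where "y k = A ^\<^sub>m k *\<^sub>v x" for k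
  define a where "a k = y k \<bullet> y k" for k
  have pow: "A ^\<^sub>m k \<in> carrier_mat n n" for k using A by simp
  have y_carrier: "y k \<in> carrier_vec n" for k using pow[of k] x by (simp add: y_def)
  have y_Suc: "y (Suc k) = A *\<^sub>v y k" for k
  proof -
    \<comment> \<open>Matrix powers are defined with the new factor on the right, while the
      recursion for \<open>y\<close> needs it on the left.\<close>
    have "A ^\<^sub>m Suc k = A * A ^\<^sub>m k"
    proof (induction k)
      case (Suc k)
      then show ?case using assoc_mult_mat[OF A pow A, of k] by simp
    qed (use A in simp)
    then show ?thesis using assoc_mult_mat_vec[OF A pow x] by (simp add: y_def)
  qed
  have "(a (Suc k))\<^sup>2 \<le> a k * a (Suc (Suc k))" for k
  proof -
    \<comment> \<open>One factor \<open>A\<close> moves from the left \<open>y (Suc k)\<close> to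
      the right one; the resulting sign disappears when Cauchy-Schwarz squares the product.\<close>
    have "a (Suc k) = - (y k \<bullet> y (Suc (Suc k)))"
      unfolding a_def using skew_symmetric_scalar_prod[OF A skew y_carrier y_carrier, of k "Suc k"]
      by (simp add: y_Suc)
    then show ?thesis
      using scalar_prod_Cauchy_Schwarz[OF y_carrier y_carrier, of k "Suc (Suc k)"]
      by (simp add: a_def)
  qed
  moreover have "a 0 < a 1"
    using contr A x y_Suc[of 0] by (simp add: a_def y_def)
  ultimately have unbounded: "\<exists>k. B < a k" for B
    by (intro log_convex_unbounded) (auto simp: a_def scalar_prod_self_nonneg)
  \<comment> \<open>A single \<open>c\<close> bounds every entry of every power; this is where the
    spectral radius being less than 1 enters.\<close>
  obtain c where c: "\<And>k. norm_bound (map_mat complex_of_real A ^\<^sub>m k) c"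
    using spectral_radius_jnf_norm_bound_less_1_upper_triangular[OF _ radius, of n] A by auto
  have entry: "\<bar>(A ^\<^sub>m k) $$ (i, j)\<bar> \<le> c" if "i < n" "j < n" for i j k
    using c[of k] that A of_real_hom.mat_hom_pow[OF A, of k, where ?'a = complex, symmetric]
    by (auto simp: norm_bound_def)
  \<comment> \<open>By the triangle inequality, \<open>b\<close> bounds each coordinate of each
    \<open>y k\<close>, independently of \<open>k\<close>.\<close>
  define b where "b = (\<Sum>j<n. c * \<bar>x $ j\<bar>)"
  have "(y k $ i)\<^sup>2 \<le> b\<^sup>2" if i: "i < n" for i k
  proof -
    have "y k $ i = (\<Sum>j<n. (A ^\<^sub>m k) $$ (i, j) * x $ j)"
      using A x i by (simp add: y_def scalar_prod_def lessThan_atLeast0)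
    also have "\<bar>\<dots>\<bar> \<le> b"
      unfolding b_def using i entry
      by (intro order.trans[OF sum_abs] sum_mono) (auto simp: abs_mult intro: mult_right_mono)
    finally show ?thesis by (metis abs_le_square_iff abs_ge_self order_trans)
  qed
  then have "(\<Sum>i<n. (y k $ i)\<^sup>2) \<le> (\<Sum>i<n. b\<^sup>2)" for k
    by (intro sum_mono) simp
  then have "a k \<le> (\<Sum>i<n. b\<^sup>2)" for k
    using y_carrier[of k] by (simp add: a_def scalar_prod_def lessThan_atLeast0 power2_eq_square)
  then show False using unbounded[of "\<Sum>i<n. b\<^sup>2"] by (meson not_le)
qed

theorem skew_symmetric_norm_le_spectral_radius:
  fixes A :: "real mat"
  assumes A: "A \<in> carrier_mat n n" and skew: "transpose_mat A = - A"
    and x: "x \<in> carrier_vec n" and n: "n > 0"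
  shows "sqrt ((A *\<^sub>v x) \<bullet> (A *\<^sub>v x)) \<le> spectral_radius (map_mat complex_of_real A) * sqrt (x \<bullet> x)"
    (is "_ \<le> ?\<rho> * _")
proof -
  \<comment> \<open>Dividing \<open>A\<close> by some \<open>t\<close> strictly above
    \<open>?\<rho>\<close> brings the spectral radius strictly below 1, and \<open>t\<close> is
    positive even if \<open>?\<rho>\<close> is 0.\<close>
  have bound: "sqrt ((A *\<^sub>v x) \<bullet> (A *\<^sub>v x)) \<le> t * sqrt (x \<bullet> x)" if t: "?\<rho> < t" for t
  proof -
    have AC: "map_mat complex_of_real A \<in> carrier_mat n n" using A by simp
    have t0: "t > 0" using t spectral_radius_nonneg[OF AC n] by linarith
    define B where "B = (1 / t) \<cdot>\<^sub>m A"
    have B: "B \<in> carrier_mat n n" using A by (simp add: B_def)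
    have hom: "map_mat complex_of_real B = complex_of_real (1 / t) \<cdot>\<^sub>m map_mat complex_of_real A"
      unfolding B_def by (intro eq_matI) auto
    have "spectral_radius (map_mat complex_of_real B) \<le> norm (complex_of_real (1 / t)) * ?\<rho>"
      unfolding hom using t0 by (intro spectral_radius_smult_le[OF AC n]) auto
    also have "\<dots> < 1" using t t0 by (simp add: norm_divide)
    finally have radius: "spectral_radius (map_mat complex_of_real B) < 1" .
    have "transpose_mat B = (1 / t) \<cdot>\<^sub>m transpose_mat A"
      unfolding B_def by (intro eq_matI) auto
    also have "\<dots> = - B"
      using A unfolding skew B_def by (intro eq_matI) auto
    finally have "transpose_mat B = - B" .
    note skew_symmetric_contraction[OF B this x radius]
    moreover have "B *\<^sub>v x = (1 / t) \<cdot>\<^sub>v (A *\<^sub>v x)"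
      using A x by (simp add: B_def smult_mat_mult_vec)
    ultimately have "(A *\<^sub>v x) \<bullet> (A *\<^sub>v x) \<le> t\<^sup>2 * (x \<bullet> x)"
      using t0 by (simp add: field_simps power2_eq_square)
    from real_sqrt_le_mono[OF this] show ?thesis using t0 by (simp add: real_sqrt_mult)
  qed
  show ?thesis
  proof (cases "x \<bullet> x = 0")
    case True
    then show ?thesis using bound[of "?\<rho> + 1"] by simp
  next
    case False
    then have pos: "0 < sqrt (x \<bullet> x)" using scalar_prod_self_nonneg[of x] by simp
    have "sqrt ((A *\<^sub>v x) \<bullet> (A *\<^sub>v x)) / sqrt (x \<bullet> x) \<le> ?\<rho>"
    \<comment> \<open>The quotient is at most every \<open>t\<close> above \<open>?\<rho>\<close>,
      hence at most \<open>?\<rho>\<close> itself.\<close>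
    proof (rule dense_ge)
      fix t assume "?\<rho> < t"
      from bound[OF this] show "sqrt ((A *\<^sub>v x) \<bullet> (A *\<^sub>v x)) / sqrt (x \<bullet> x) \<le> t"
        using pos by (simp only: pos_divide_le_eq)
    qed
    then show ?thesis using pos by (simp only: pos_divide_le_eq)
  qed
qed

text \<open>Off the diagonal, at most one direction of an edge is an arc. On it,
  \<open>orientation_of\<close> with equal endpoints rules out loops, so the entries are 0.\<close>

lemma transpose_skew_adjacency_matrix:
  assumes "orientation_of D G"
  shows "transpose_mat (skew_adjacency_matrix D n v) = - skew_adjacency_matrix D n v"
  using assms by (intro eq_matI) (auto simp: skew_adjacency_matrix_def orientation_of_def)

text \<open>Each out-arc contributes 1 to the row sum and each in-arc -1; the bijection
  \<open>v\<close> turns counting arcs into counting column indices.\<close>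

lemma degree_diff_eq_sum:
  assumes G: "pair_graph G" and ori: "orientation_of D G"
    and bij: "bij_betw v {..<n} (pverts D)" and i: "i < n"
  shows "real_of_int (degree_diff D (v i)) = (\<Sum>j<n. skew_adjacency_matrix D n v $$ (i, j))"
proof -
  interpret pair_graph G by (rule G)
  have verts: "v ` {..<n} = pverts G" and inj: "inj_on v {..<n}"
    using bij ori by (auto simp: bij_betw_def orientation_of_def)
  \<comment> \<open>Arcs of \<open>D\<close> are arcs of the well-formed \<open>G\<close>, so the
    enumeration reaches both endpoints.\<close>
  have mem: "(\<exists>j<n. a = v j) \<and> (\<exists>j<n. b = v j)" if "(a, b) \<in> parcs D" for a b
  proof -
    have "a \<in> v ` {..<n}" "b \<in> v ` {..<n}"
      using that ori wellformed' unfolding verts orientation_of_def by blast+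
    then show ?thesis by auto
  qed
  have anti: "(b, a) \<notin> parcs D" if "(a, b) \<in> parcs D" for a b
    using that ori unfolding orientation_of_def by blast
  have "out_arcs (with_proj D) (v i) = (\<lambda>j. (v i, v j)) ` {j \<in> {..<n}. (v i, v j) \<in> parcs D}"
    by (auto simp: out_arcs_def image_iff) (metis mem)
  moreover have "inj_on (\<lambda>j. (v i, v j)) {j \<in> {..<n}. (v i, v j) \<in> parcs D}"
    using inj by (auto simp: inj_on_def)
  ultimately have out_deg: "out_degree (with_proj D) (v i) = card {j \<in> {..<n}. (v i, v j) \<in> parcs D}"
    by (simp add: out_degree_def card_image)
  have "in_arcs (with_proj D) (v i) = (\<lambda>j. (v j, v i)) ` {j \<in> {..<n}. (v j, v i) \<in> parcs D}"
    by (auto simp: in_arcs_def image_iff) (metis mem)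
  moreover have "inj_on (\<lambda>j. (v j, v i)) {j \<in> {..<n}. (v j, v i) \<in> parcs D}"
    using inj by (auto simp: inj_on_def)
  ultimately have in_deg: "in_degree (with_proj D) (v i) = card {j \<in> {..<n}. (v j, v i) \<in> parcs D}"
    by (simp add: in_degree_def card_image)
  \<comment> \<open>By \<open>anti\<close> the two indicators are never both 1, so their difference
    agrees with the nested conditional.\<close>
  have "(\<Sum>j<n. skew_adjacency_matrix D n v $$ (i, j)) =
      (\<Sum>j<n. of_bool ((v i, v j) \<in> parcs D) - of_bool ((v j, v i) \<in> parcs D))"
    using i anti by (intro sum.cong) (auto simp: skew_adjacency_matrix_def)
  also have "\<dots> = real (card {j \<in> {..<n}. (v i, v j) \<in> parcs D})
      - real (card {j \<in> {..<n}. (v j, v i) \<in> parcs D})"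
    by (simp add: sum_subtractf Int_def)
  finally show ?thesis by (simp add: degree_diff_def out_deg in_deg)
qed

theorem theorem2p6:
  fixes G D :: "'a pair_pre_digraph" and n :: nat and v :: "nat \<Rightarrow> 'a"
  assumes "pair_graph G"
    and "orientation_of D G"
    and "n \<ge> 1"
    and "bij_betw v {..<n} (pverts D)"
  shows "skew_spectral_radius D n v
           \<ge> sqrt ((\<Sum>i<n. (real_of_int (degree_diff D (v i)))\<^sup>2) / real n)"
proof -
  define S where "S = skew_adjacency_matrix D n v"
  \<comment> \<open>Multiplying \<open>S\<close> by the all-ones vector yields its row sums.\<close>
  define x :: "real vec" where "x = vec n (\<lambda>_. 1)"
  have S: "S \<in> carrier_mat n n" by (simp add: S_def skew_adjacency_matrix_def)
  have x: "x \<in> carrier_vec n" by (simp add: x_def)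
  have "(S *\<^sub>v x) $ i = real_of_int (degree_diff D (v i))" if "i < n" for i
    using S that degree_diff_eq_sum[OF assms(1,2,4) that]
    by (simp add: x_def scalar_prod_def S_def lessThan_atLeast0)
  then have "(S *\<^sub>v x) \<bullet> (S *\<^sub>v x) = (\<Sum>i<n. (real_of_int (degree_diff D (v i)))\<^sup>2)"
    using S by (simp add: scalar_prod_def power2_eq_square lessThan_atLeast0)
  moreover have "x \<bullet> x = real n" by (simp add: x_def scalar_prod_def)
  ultimately show ?thesis
    using skew_symmetric_norm_le_spectral_radius[OF S _ x] transpose_skew_adjacency_matrix[OF assms(2)] assms(3)
    by (simp add: skew_spectral_radius_def S_def real_sqrt_divide field_simps)
qed

end
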